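(* Let $m,n$ be natural numbers (positive integers) with $m\neq 1$ and $n\ne 1$, let $K_{m,n}$ be the complete bipartite graph with parts of sizes $m$ and $n$, let $e$ be an edge of $K_{m,n}$, and let $K_{m,n}-e$ be the graph obtained by deleting the edge $e$ (keeping all vertices). Then: (i) the Randić characteristic polynomial of $K_{m,n}-e$ is $$RP(K_{m,n}-e,\lambda)=\lambda^{m+n-4}(\lambda^2-1)\left(\lambda^2-\tfrac{1}{mn}\right);$$ (ii) the Randić energy of $K_{m,n}-e$ is $RE(K_{m,n}-e)=2+\frac{2}{\sqrt{mn}}$.
   Context: All graphs are finite and simple. For a graph $G$ with vertices $v_1,\dots,v_N$ of degrees $d_1,\dots,d_N$, the Randić matrix $R(G)$ is the $N\times N$ real symmetric matrix with $(i,j)$-entry $\frac{1}{\sqrt{d_id_j}}$ if $v_i$ and $v_j$ are adjacent, and $0$ otherwise. The Randić characteristic polynomial of $G$ is $RP(G,\lambda)=\det(\lambda I-R(G))$. The Randić energy of $G$ is $RE(G)=\sum_{i=1}^N|\rho_i|$, where $\rho_1,\dots,\rho_N$ are the eigenvalues of $R(G)$ counted with multiplicity. *)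

theory Defs
  imports
    "Graph_Theory.Kuratowski"
    "Jordan_Normal_Form.Char_Poly"
    "Jordan_Normal_Form.Spectral_Radius"
begin

text \<open>
  A finite simple graph is a symmetric, loop-free, finite \<^typ>\<open>'a pair_pre_digraph\<close>
  (\<^locale>\<open>pair_graph\<close>). An edge \<open>uv\<close> is the pair of arcs \<open>(u,v)\<close>, \<open>(v,u)\<close>, so the degree of a
  vertex is its out-degree, and deleting an edge removes both arcs.
\<close>

definition del_edge :: "'a pair_pre_digraph \<Rightarrow> 'a \<times> 'a \<Rightarrow> 'a pair_pre_digraph" where
  "del_edge G e = G\<lparr>parcs := parcs G - {e, (snd e, fst e)}\<rparr>"

text \<open>
  The list \<open>vs\<close> is the enumeration \<open>v\<^sub>1, \<dots>, v\<^sub>N\<close> of the vertices that indexes rows and columns.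
\<close>

definition vertex_enum :: "'a list \<Rightarrow> 'a pair_pre_digraph \<Rightarrow> bool" where
  "vertex_enum vs G \<longleftrightarrow> distinct vs \<and> set vs = pverts G"

definition randic_matrix :: "'a list \<Rightarrow> 'a pair_pre_digraph \<Rightarrow> real mat" where
  "randic_matrix vs G = mat (length vs) (length vs) (\<lambda>(i, j).
     if (vs ! i, vs ! j) \<in> parcs G
     then 1 / sqrt (real (out_degree (with_proj G) (vs ! i)) * real (out_degree (with_proj G) (vs ! j)))
     else 0)"

definition randic_char_poly :: "'a list \<Rightarrow> 'a pair_pre_digraph \<Rightarrow> real poly" where
  "randic_char_poly vs G = char_poly (randic_matrix vs G)"

text \<open>
  The Randic matrix is real symmetric, so all its eigenvalues are real, and the multiplicity of an
  eigenvalue is its order as a root of the characteristic polynomial.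
\<close>

definition randic_energy :: "'a list \<Rightarrow> 'a pair_pre_digraph \<Rightarrow> real" where
  "randic_energy vs G =
     (\<Sum>\<rho>\<in>spectrum (randic_matrix vs G). real (order \<rho> (randic_char_poly vs G)) * \<bar>\<rho>\<bar>)"

end

theory Submission
  imports Defs
begin

text \<open>
  Deleting the edge \<open>ab\<close> leaves four classes of vertices, \<open>{a}\<close>, \<open>U - {a}\<close>, \<open>{b}\<close>, \<open>V - {b}\<close>, and
  both degree and adjacency depend only on classes. Hence the Randic matrix factors as \<open>P * Q\<close>
  through a four-dimensional space, and \<open>char_poly (P * Q) * X^4 = X^N * char_poly (Q * P)\<close> reduces
  the computation to a 4 by 4 matrix. Splitting each entry \<open>1 / sqrt (d d')\<close> evenly
  between \<open>P\<close> and \<open>Q\<close> removes all square roots from \<open>Q * P\<close>.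
\<close>

section \<open>Commuting the factors in a characteristic polynomial\<close>

text \<open>Both \<open>?L\<close> from the left and \<open>?R\<close> from the right clear the
  upper right block of \<open>?B\<close>, exposing \<open>P * Q\<close> and \<open>Q * P\<close>
  respectively; compare determinants. The block \<open>x \<cdot>\<^sub>m 1\<^sub>m k\<close> in
  \<open>?R\<close> avoids dividing by \<open>x\<close>.\<close>

lemma det_scalar_minus_mult_commute:
  fixes P Q :: "'a :: idom mat"
  assumes P: "P \<in> carrier_mat n k" and Q: "Q \<in> carrier_mat k n"
  shows "det (x \<cdot>\<^sub>m 1\<^sub>m n - P * Q) * x ^ k = x ^ n * det (x \<cdot>\<^sub>m 1\<^sub>m k - Q * P)"
proof -
  let ?B = "four_block_mat (x \<cdot>\<^sub>m 1\<^sub>m n) P Q (1\<^sub>m k)"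
  let ?L = "four_block_mat (1\<^sub>m n) (- P) (0\<^sub>m k n) (1\<^sub>m k)"
  let ?R = "four_block_mat (1\<^sub>m n) (- P) (0\<^sub>m k n) (x \<cdot>\<^sub>m 1\<^sub>m k)"
  have cB: "?B \<in> carrier_mat (n + k) (n + k)" "?L \<in> carrier_mat (n + k) (n + k)"
    "?R \<in> carrier_mat (n + k) (n + k)"
    by auto
  have cPQ: "x \<cdot>\<^sub>m 1\<^sub>m n - P * Q \<in> carrier_mat n n" "x \<cdot>\<^sub>m 1\<^sub>m k - Q * P \<in> carrier_mat k k"
    using P Q by auto
  have "?L * ?B = four_block_mat (x \<cdot>\<^sub>m 1\<^sub>m n - P * Q) (0\<^sub>m n k) Q (1\<^sub>m k)"
    by (subst mult_four_block_mat[of _ n n _ k _ k _ _ n _ k])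
      (use P Q in \<open>auto intro!: cong_four_block_mat eq_matI\<close>)
  then have "det ?L * det ?B = det (x \<cdot>\<^sub>m 1\<^sub>m n - P * Q)"
    using det_mult[OF cB(2,1)] Q cPQ(1)
    by (simp add: det_four_block_mat_upper_right_zero[of _ n _ k])
  moreover have "det ?L = 1"
    using P by (simp add: det_four_block_mat_lower_left_zero[of _ n _ k])
  moreover have "(x \<cdot>\<^sub>m 1\<^sub>m n) * - P + P * (x \<cdot>\<^sub>m 1\<^sub>m k) = 0\<^sub>m n k"
    using P by (simp add: mult_smult_assoc_mat[of _ n n _ k] mult_smult_distrib[of _ n k _ k])
  then have "?B * ?R = four_block_mat (x \<cdot>\<^sub>m 1\<^sub>m n) (0\<^sub>m n k) Q (x \<cdot>\<^sub>m 1\<^sub>m k - Q * P)"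
    by (subst mult_four_block_mat[of _ n n _ k _ k _ _ n _ k])
      (use P Q in \<open>auto intro!: cong_four_block_mat\<close>)
  then have "det ?B * det ?R = x ^ n * det (x \<cdot>\<^sub>m 1\<^sub>m k - Q * P)"
    using det_mult[OF cB(1,3)] Q cPQ(2)
    by (simp add: det_four_block_mat_upper_right_zero[of _ n _ k])
  moreover have "det ?R = x ^ k"
    using P by (simp add: det_four_block_mat_lower_left_zero[of _ n _ k])
  ultimately show ?thesis by simp
qed

text \<open>The determinant identity over polynomials, with \<open>x\<close> the indeterminate and
  \<open>P\<close>, \<open>Q\<close> read as constant matrices.\<close>

lemma char_poly_mult_commute:
  fixes P Q :: "'a :: idom mat"
  assumes P: "P \<in> carrier_mat n k" and Q: "Q \<in> carrier_mat k n"
  shows "char_poly (P * Q) * [:0, 1:] ^ k = [:0, 1:] ^ n * char_poly (Q * P)"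
proof -
  interpret C: comm_ring_hom "\<lambda>a :: 'a. [:a:]"
    by unfold_locales auto
  have "char_poly (A * B) = det ([:0, 1:] \<cdot>\<^sub>m 1\<^sub>m i - map_mat (\<lambda>a. [:a:]) A * map_mat (\<lambda>a. [:a:]) B)"
    if "A \<in> carrier_mat i j" "B \<in> carrier_mat j i" for A B :: "'a mat" and i j
    unfolding char_poly_defs C.mat_hom_mult[OF that, symmetric]
    by (rule arg_cong[of _ _ det], rule eq_matI) (use that in auto)
  from this[OF P Q] this[OF Q P] show ?thesis
    using P Q by (simp add: det_scalar_minus_mult_commute[of _ n k])
qed

text \<open>Row \<open>i\<close> of \<open>?P\<close> has its only entry in column
  \<open>c i\<close>. In \<open>?Q * ?P\<close> the sum over \<open>j\<close> thus sees only
  \<open>c j = s\<close>, where the summand is constant; this yields the class size.\<close>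

lemma char_poly_class_mat:
  fixes g :: "nat \<Rightarrow> 'a :: idom"
  assumes c: "\<And>i. i < N \<Longrightarrow> c i < k"
  shows "char_poly (mat N N (\<lambda>(i, j). g (c i) * h (c i) (c j))) * [:0, 1:] ^ k =
    [:0, 1:] ^ N * char_poly (mat k k (\<lambda>(r, s). of_nat (card {j. j < N \<and> c j = s}) * (h r s * g s)))"
proof -
  let ?P = "mat N k (\<lambda>(i, r). if r = c i then g r else 0)"
  let ?Q = "mat k N (\<lambda>(r, j). h r (c j))"
  have "?P * ?Q = mat N N (\<lambda>(i, j). g (c i) * h (c i) (c j))"
    by (rule eq_matI) (auto simp: scalar_prod_def c if_distrib[of "\<lambda>x. x * _"] cong: if_cong)
  moreover have "?Q * ?P = mat k k (\<lambda>(r, s). of_nat (card {j. j < N \<and> c j = s}) * (h r s * g s))"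
  proof (rule eq_matI, goal_cases)
    case (1 r s)
    have "(\<Sum>j = 0..<N. h r (c j) * (if s = c j then g s else 0)) =
        (\<Sum>j | j \<in> {0..<N} \<and> c j = s. h r s * g s)"
      by (subst sum.inter_filter) (auto intro: sum.cong)
    with 1 show ?case by (simp add: scalar_prod_def)
  qed auto
  ultimately show ?thesis
    using char_poly_mult_commute[of ?P N k ?Q] by simp
qed

section \<open>Determinant expansion and root multiplicities\<close>

text \<open>Laplace expansion along the first row, shaped as a rewrite rule on entry functions; the
  \<open>if\<close> skips the deleted column \<open>j\<close>.\<close>

lemma det_mat_Suc:
  "det (mat (Suc n) (Suc n) f :: 'a :: comm_ring_1 mat) =
    (\<Sum>j < Suc n. f (0, j) * ((-1) ^ j *
      det (mat n n (\<lambda>(i, l). f (Suc i, if l < j then l else Suc l)))))"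
proof -
  have "cofactor (mat (Suc n) (Suc n) f) 0 j =
      (-1) ^ j * det (mat n n (\<lambda>(i, l). f (Suc i, if l < j then l else Suc l)))" for j
    unfolding cofactor_def mat_delete_def
    by (auto intro!: arg_cong[of _ _ "\<lambda>A. _ * det A"])
  then show ?thesis
    using laplace_expansion_row[of "mat (Suc n) (Suc n) f" "Suc n" 0] by simp
qed

text \<open>The order of \<open>r\<close> is its number of occurrences in \<open>as\<close>, so
  weighting distinct roots by order recovers the sum over the list.\<close>

lemma sum_order_linear_factors:
  fixes as :: "'a :: idom list" and f :: "'a \<Rightarrow> 'b :: comm_semiring_1"
  defines "p \<equiv> \<Prod>a\<leftarrow>as. [:- a, 1:]"
  shows "(\<Sum>r | poly p r = 0. of_nat (order r p) * f r) = (\<Sum>a\<leftarrow>as. f a)"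
proof -
  have nz: "(\<Prod>a\<leftarrow>as. [:- a, 1:]) \<noteq> 0" for as :: "'a list"
    by auto
  have "order r p = count_list as r" for r
    unfolding p_def
  proof (induction as)
    case (Cons a as)
    have "order r (\<Prod>x\<leftarrow>a # as. [:- x, 1:]) =
        order r [:- a, 1:] + order r (\<Prod>x\<leftarrow>as. [:- x, 1:])"
      using order_mult[of "[:- a, 1:]" "\<Prod>x\<leftarrow>as. [:- x, 1:]"] nz[of "a # as"]
      unfolding list.map prod_list.Cons .
    with Cons show ?case by (simp add: order_linear')
  qed simp
  moreover have "{r. poly p r = 0} = set as"
    unfolding p_def by (induction as) auto
  \<comment> \<open>\<open>S\<close> is kept apart from \<open>as\<close> because the root set may
    shrink during the induction.\<close>
  moreover have "(\<Sum>r\<in>S. of_nat (count_list as r) * f r) = (\<Sum>a\<leftarrow>as. f a)"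
    if "finite S" "set as \<subseteq> S" for S
    using that(2)
  proof (induction as)
    case (Cons a as)
    have "(\<Sum>r\<in>S. of_nat (count_list (a # as) r) * f r) =
        (\<Sum>r\<in>S. (if a = r then f r else 0) + of_nat (count_list as r) * f r)"
      by (rule sum.cong) (auto simp: algebra_simps)
    with Cons that(1) show ?case by (simp add: sum.distrib)
  qed simp
  ultimately show ?thesis by simp
qed

text \<open>
  Here \<open>c\<close> lists the sizes and \<open>d\<close> the degrees of the vertex classes \<open>{a}\<close>, \<open>U - {a}\<close>, \<open>{b}\<close>, \<open>V - {b}\<close>,
  where \<open>m\<close> and \<open>n\<close> stand for \<open>card U\<close> and \<open>card V\<close>.
\<close>

lemma char_poly_quotient_mat:
  fixes m n :: real
  assumes "m > 1" "n > 1"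
  defines "d \<equiv> \<lambda>s. [n - 1, n, m - 1, m] ! s" and "c \<equiv> \<lambda>s. [1, m - 1, 1, n - 1] ! s"
  shows "char_poly (mat 4 4 (\<lambda>(r, s).
      if (r, s) \<in> {(0, 3), (3, 0), (1, 2), (2, 1), (1, 3), (3, 1)} then c s / d s else 0)) =
    ([:0, 1:] ^ 2 - 1) * ([:0, 1:] ^ 2 - [:1 / (m * n):])" (is "char_poly ?M = _")
proof -
  let ?T = "(n - 1) / m" and ?W = "(m - 1) / n"
  \<comment> \<open>Nonzero off-diagonal entries depend only on the column, so \<open>p\<close> and
    \<open>r\<close> occur twice. Symbolic entries keep fractions out of the expansion.\<close>
  have det: "det (mat 4 4 (\<lambda>(i, j). [[x, 0, 0, p], [0, x, q, p], [0, r, x, 0], [t, r, 0, x]] ! i ! j)) =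
      x ^ 4 - (p * t + q * r + p * r) * x ^ 2 + p * q * (r * t)" for x p q r t :: "real poly"
    by (simp add: numeral_eq_Suc det_mat_Suc) (simp add: algebra_simps)
  have "char_poly ?M = det (mat 4 4 (\<lambda>(i, j).
      [[[:0, 1:], 0, 0, [:- ?T:]], [0, [:0, 1:], [:- (1 / (m - 1)):], [:- ?T:]],
       [0, [:- ?W:], [:0, 1:], 0], [[:- (1 / (n - 1)):], [:- ?W:], 0, [:0, 1:]]] ! i ! j))"
    unfolding char_poly_defs
  proof (rule arg_cong[of _ _ det], rule eq_matI, goal_cases)
    case (1 i j)
    then have "i = 0 \<or> i = 1 \<or> i = 2 \<or> i = 3" "j = 0 \<or> j = 1 \<or> j = 2 \<or> j = 3"
      by auto
    then show ?case
      by (elim disjE) (simp_all add: c_def d_def)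
  qed auto
  also have "\<dots> = [:0, 1:] ^ 4 - [:?T / (n - 1) + ?W / (m - 1) + ?T * ?W:] * [:0, 1:] ^ 2 +
      [:?T / (m - 1) * (?W / (n - 1)):]"
    unfolding det by (simp add: mult.commute)
  \<comment> \<open>The two coefficients turn out to be the sum and the product of 1 and
    \<open>1 / (m * n)\<close>, which gives the factorization in the squared variable.\<close>
  also have "?T / (n - 1) + ?W / (m - 1) + ?T * ?W = 1 / m + 1 / n + ?T * ?W"
    using assms(1,2) by simp
  also have "\<dots> = 1 + 1 / (m * n)"
    using assms(1,2) by (simp add: field_simps)
  also have "?T / (m - 1) * (?W / (n - 1)) = 1 / (m * n)"
    using assms(1,2) by simp
  finally show ?thesis
    by (simp add: numeral_eq_Suc algebra_simps one_pCons)
qed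

section \<open>Vertex classes after deleting the edge\<close>

context
  fixes U V :: "'a set" and a b :: 'a and H :: "'a pair_pre_digraph"
  assumes UV: "finite U" "finite V" "U \<inter> V = {}" "a \<in> U" "b \<in> V"
    and H: "pverts H = U \<union> V" "parcs H = U \<times> V \<union> V \<times> U - {(a, b), (b, a)}"
begin

text \<open>The values index the lists of class sizes and degrees. They stay below 4 even outside
  \<open>U \<union> V\<close>.\<close>

definition vertex_class :: "'a \<Rightarrow> nat" where
  "vertex_class v = (if v = a then 0 else if v \<in> U then 1 else if v = b then 2 else 3)"

text \<open>Classes 0 and 1 make up \<open>U\<close>, 2 and 3 make up \<open>V\<close>; the missing
  pairing of 0 with 2 is the deleted edge.\<close>

lemma parcs_iff_vertex_class:
  assumes "v \<in> U \<union> V" "w \<in> U \<union> V"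
  shows "(v, w) \<in> parcs H \<longleftrightarrow> (vertex_class v, vertex_class w) \<in>
    {(0, 3), (3, 0), (1, 2), (2, 1), (1, 3), (3, 1)}"
  using assms UV unfolding H vertex_class_def by auto

lemma out_degree_vertex_class:
  assumes "v \<in> U \<union> V"
  shows "out_degree (with_proj H) v =
    [card V - 1, card V, card U - 1, card U] ! vertex_class v"
proof -
  have "out_arcs (with_proj H) v = {v} \<times> (if v = a then V - {b} else if v \<in> U then V else
      if v = b then U - {a} else U)"
    using assms UV unfolding out_arcs_def by (auto simp: H)
  then show ?thesis
    using UV by (simp add: out_degree_def card_cartesian_product vertex_class_def)
qed

lemma card_vertex_class:
  assumes "s < 4"
  shows "card {v \<in> U \<union> V. vertex_class v = s} = [1, card U - 1, 1, card V - 1] ! s"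
proof -
  have "{v \<in> U \<union> V. vertex_class v = s} = [{a}, U - {a}, {b}, V - {b}] ! s"
    using assms UV by (auto simp: numeral_eq_Suc less_Suc_eq vertex_class_def)
  then show ?thesis
    using assms UV by (auto simp: numeral_eq_Suc less_Suc_eq)
qed

lemma randic_char_poly_complete_bipartite_minus_edge:
  assumes cards: "card U \<ge> 2" "card V \<ge> 2" and vs: "vertex_enum vs H"
  shows "randic_char_poly vs H = [:0, 1:] ^ (card U + card V - 4) *
    ([:0, 1:] ^ 2 - 1) * ([:0, 1:] ^ 2 - [:1 / (real (card U) * real (card V)):])"
proof -
  let ?m = "real (card U)" and ?n = "real (card V)" and ?N = "card U + card V"
  define d where "d = (\<lambda>s. [?n - 1, ?n, ?m - 1, ?m] ! s)"
  define adj :: "(nat \<times> nat) set" where "adj = {(0, 3), (3, 0), (1, 2), (2, 1), (1, 3), (3, 1)}"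
  define c where "c = (\<lambda>i. vertex_class (vs ! i))"
  define g where "g = (\<lambda>r. 1 / sqrt (d r))"
  define h where "h = (\<lambda>r s. if (r, s) \<in> adj then 1 / sqrt (d s) else 0)"
  have dist: "distinct vs" and set: "set vs = U \<union> V"
    using vs by (auto simp: vertex_enum_def H)
  have len: "length vs = ?N"
    using distinct_card[OF dist] UV by (simp add: set card_Un_disjoint)
  have in_UV: "vs ! i \<in> U \<union> V" if "i < ?N" for i
    using that len set nth_mem by metis
  have c: "c i < 4" for i
    by (simp add: c_def vertex_class_def)
  \<comment> \<open>By \<open>cards\<close>, natural subtraction in the degrees agrees with real
    subtraction.\<close>
  have deg: "real (out_degree (with_proj H) (vs ! i)) = d (c i)" if "i < ?N" for i
    using cards c[of i] unfolding out_degree_vertex_class[OF in_UV[OF that]]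
    by (auto simp: c_def d_def numeral_eq_Suc less_Suc_eq)
  have adj: "(vs ! i, vs ! j) \<in> parcs H \<longleftrightarrow> (c i, c j) \<in> adj" if "i < ?N" "j < ?N" for i j
    using parcs_iff_vertex_class[OF in_UV in_UV, OF that] by (simp add: adj_def c_def)
  have R: "randic_matrix vs H = mat ?N ?N (\<lambda>(i, j). g (c i) * h (c i) (c j))"
    unfolding randic_matrix_def len
    by (rule eq_matI)
      (auto simp: deg adj g_def h_def real_sqrt_mult)
  have count: "real (card {j. j < ?N \<and> c j = s}) = [1, ?m - 1, 1, ?n - 1] ! s" if "s < 4" for s
  proof -
    have "bij_betw ((!) vs) {j. j < ?N \<and> c j = s} {v \<in> U \<union> V. vertex_class v = s}"
      using bij_betw_nth[OF dist refl refl] in_UV unfolding len set c_def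
      by (auto simp: bij_betw_def inj_on_def)
    then show ?thesis
      using card_vertex_class[OF that] that cards
      by (auto simp: bij_betw_same_card numeral_eq_Suc less_Suc_eq)
  qed
  have d_pos: "d s > 0" if "s < 4" for s
    using that cards by (auto simp: d_def numeral_eq_Suc less_Suc_eq)
  \<comment> \<open>Both \<open>h r s\<close> and \<open>g s\<close> carry the root of the same
    \<open>d s\<close>, so they multiply to \<open>1 / d s\<close>.\<close>
  have "mat 4 4 (\<lambda>(r, s). of_nat (card {j. j < ?N \<and> c j = s}) * (h r s * g s)) =
      mat 4 4 (\<lambda>(r, s). if (r, s) \<in> adj then [1, ?m - 1, 1, ?n - 1] ! s / d s else 0)"
    by (rule eq_matI) (auto simp: count h_def g_def d_pos less_imp_le)
  then have "randic_char_poly vs H * [:0, 1:] ^ 4 = [:0, 1:] ^ ?N *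
      (([:0, 1:] ^ 2 - 1) * ([:0, 1:] ^ 2 - [:1 / (?m * ?n):]))"
    using char_poly_class_mat[of ?N c 4 g h, OF c] char_poly_quotient_mat[of ?m ?n] cards
    unfolding randic_char_poly_def R d_def adj_def by simp
  \<comment> \<open>There are at least four vertices, so the factor \<open>[:0, 1:] ^ 4\<close>
    splits off and cancels.\<close>
  also have "[:0, 1 :: real:] ^ ?N = [:0, 1:] ^ (?N - 4) * [:0, 1:] ^ 4"
    using cards by (simp flip: power_add)
  finally show ?thesis
    by (simp add: mult_ac)
qed

end

section \<open>Energy and conclusion\<close>

lemma randic_energy_eq_sum_list:
  assumes "randic_char_poly vs G = (\<Prod>a\<leftarrow>as. [:- a, 1:])"
  shows "randic_energy vs G = (\<Sum>a\<leftarrow>as. \<bar>a\<bar>)"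
proof -
  have "randic_matrix vs G \<in> carrier_mat (length vs) (length vs)"
    by (simp add: randic_matrix_def)
  then show ?thesis
    using sum_order_linear_factors[of as abs] assms
    by (simp add: randic_energy_def spectrum_root_char_poly flip: randic_char_poly_def)
qed

theorem theorem9:
  fixes m n :: nat and G :: "'a pair_pre_digraph" and e :: "'a \<times> 'a" and vs :: "'a list"
  assumes "m > 0" and "n > 0" and "m \<noteq> 1" and "n \<noteq> 1"
    and "complete_bipartite_digraph m n (with_proj G)"
    and "e \<in> parcs G"
    and "vertex_enum vs (del_edge G e)"
  shows "randic_char_poly vs (del_edge G e) =
           [:0, 1:] ^ (m + n - 4) * ([:0, 1:] ^ 2 - 1) * ([:0, 1:] ^ 2 - [:1 / (real m * real n):])
       \<and> randic_energy vs (del_edge G e) = 2 + 2 / sqrt (real m * real n)"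
proof
  obtain U V where UV: "pverts G = U \<union> V" "U \<inter> V = {}" "card U = m" "card V = n"
    "parcs G = U \<times> V \<union> V \<times> U"
    using assms(5) unfolding complete_bipartite_digraph_pair_def by blast
  \<comment> \<open>The arc \<open>e\<close> may point either way; deletion removes both arcs, so
    the two cases give the same graph.\<close>
  then obtain a b where ab: "a \<in> U" "b \<in> V" and e: "e = (a, b) \<or> e = (b, a)"
    using assms(6) by auto
  \<comment> \<open>Infinite sets have \<open>card\<close> 0, so positive sizes force
    finiteness.\<close>
  have fin: "finite U" "finite V"
    using UV assms(1,2) card_ge_0_finite by blast+
  have H: "pverts (del_edge G e) = U \<union> V"
    "parcs (del_edge G e) = U \<times> V \<union> V \<times> U - {(a, b), (b, a)}"
    using e UV by (auto simp: del_edge_def)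
  have "card U \<ge> 2" "card V \<ge> 2"
    using assms(1-4) UV by auto
  from randic_char_poly_complete_bipartite_minus_edge[OF fin UV(2) ab H this assms(7)]
  show cp: "randic_char_poly vs (del_edge G e) =
      [:0, 1:] ^ (m + n - 4) * ([:0, 1:] ^ 2 - 1) * ([:0, 1:] ^ 2 - [:1 / (real m * real n):])"
    unfolding UV .
  \<comment> \<open>The nonzero eigenvalues are 1, -1, \<open>s\<close> and \<open>- s\<close>; the
    zeros add nothing to the energy.\<close>
  define s where "s = 1 / sqrt (real m * real n)"
  let ?as = "replicate (m + n - 4) 0 @ [1, - 1, s, - s]"
  have "[:0, 1:] ^ 2 - [:1 / (real m * real n):] = [:- s, 1:] * [:s, 1:]"
    by (simp add: s_def power2_eq_square)
  moreover have "[:0, 1:] ^ 2 - 1 = [:- 1, 1:] * [:1, 1 :: real:]"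
    by (simp add: power2_eq_square one_pCons)
  ultimately have "randic_char_poly vs (del_edge G e) = (\<Prod>a\<leftarrow>?as. [:- a, 1:])"
    unfolding cp by (simp only: map_append prod_list.append map_replicate prod_list_replicate mult.assoc
      list.map prod_list.Cons prod_list.Nil minus_zero minus_minus mult_1_right)
  from randic_energy_eq_sum_list[OF this]
  show "randic_energy vs (del_edge G e) = 2 + 2 / sqrt (real m * real n)"
    by (simp add: s_def sum_list_replicate)
qed

end
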